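(* Let $\Gamma=\{(\cosh t,\ \sinh t): t\in\mathbb R\}\subset\mathbb R^2$ and let $\Lambda=L_1\cup L_2$, where $L_1,L_2\subset\mathbb R^2$ are any two different straight lines parallel to the $X$-axis. Then $(\Gamma,\Lambda)$ is a Heisenberg uniqueness pair.
   Context: For a curve $\Gamma\subset\mathbb R^2$ (a finite disjoint union of smooth curves), $X(\Gamma)$ denotes the space of all finite complex-valued Borel measures $\mu$ on $\mathbb R^2$ that are supported on $\Gamma$ and absolutely continuous with respect to the arc length measure on $\Gamma$. The Fourier transform of $\mu$ is $\hat\mu(\xi,\eta)=\int_\Gamma e^{-i\pi(x\xi+y\eta)}\,d\mu(x,y)$ for $(\xi,\eta)\in\mathbb R^2$. For a set $\Lambda\subset\mathbb R^2$, the pair $(\Gamma,\Lambda)$ is a Heisenberg uniqueness pair (HUP) if every $\mu\in X(\Gamma)$ with $\hat\mu(\xi,\eta)=0$ for all $(\xi,\eta)\in\Lambda$ satisfies $\mu=0$. A line parallel to the $X$-axis is allowed to be the $X$-axis itself. *)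

theory Defs
  imports "HOL-Analysis.Analysis"
begin

section \<open>Finite complex Borel measures\<close>

text \<open>
  Set functions are only constrained on the Borel sets; their values elsewhere are irrelevant.
  Finiteness is built into the codomain, and taking all sets empty gives value 0 on the empty set.
\<close>

definition borel_countably_additive ::
    "('a::topological_space set \<Rightarrow> 'b::real_normed_vector) \<Rightarrow> bool" where
  "borel_countably_additive \<nu> \<longleftrightarrow>
     (\<forall>A::nat \<Rightarrow> 'a set. range A \<subseteq> sets borel \<and> disjoint_family A \<longrightarrow>
        (\<lambda>n. \<nu> (A n)) sums \<nu> (\<Union>n. A n))"

definition complex_borel_measure :: "('a::topological_space set \<Rightarrow> complex) \<Rightarrow> bool" where
  "complex_borel_measure \<mu> \<longleftrightarrow> borel_countably_additive \<mu>"

text \<open>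
  The positive part of the Jordan decomposition of a real signed measure,
  \<open>\<nu>\<^sup>+(A) = sup {\<nu>(B) | B \<subseteq> A Borel}\<close>; \<open>ennreal\<close> sends negative values to 0, which is harmless
  because of \<open>\<nu>({}) = 0\<close>. The negative part is the positive part of \<open>-\<nu>\<close>.
\<close>

definition positive_variation ::
    "('a::topological_space set \<Rightarrow> real) \<Rightarrow> 'a measure" where
  "positive_variation \<nu> =
     measure_of UNIV (sets borel) (\<lambda>A. SUP B\<in>{B \<in> sets borel. B \<subseteq> A}. ennreal (\<nu> B))"

definition complex_measure_integral ::
    "('a::topological_space set \<Rightarrow> complex) \<Rightarrow> ('a \<Rightarrow> complex) \<Rightarrow> complex" where
  "complex_measure_integral \<mu> f =
     (LINT x|positive_variation (\<lambda>A. Re (\<mu> A)). f x)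
     - (LINT x|positive_variation (\<lambda>A. - Re (\<mu> A)). f x)
     + \<i> * ((LINT x|positive_variation (\<lambda>A. Im (\<mu> A)). f x)
            - (LINT x|positive_variation (\<lambda>A. - Im (\<mu> A)). f x))"

lemma borel_countably_additive_empty:
  assumes "borel_countably_additive \<nu>"
  shows "\<nu> {} = 0"
proof -
  have "(\<lambda>n::nat. \<nu> {}) sums \<nu> (\<Union>n::nat. {})"
    using assms[unfolded borel_countably_additive_def, rule_format, of "\<lambda>_. {}"]
    by (auto simp: disjoint_family_on_def)
  then show ?thesis
    by (metis sums_summable summable_const_iff)
qed

lemma borel_countably_additive_Un:
  assumes "borel_countably_additive \<nu>" "A \<in> sets borel" "B \<in> sets borel" "A \<inter> B = {}"
  shows "\<nu> (A \<union> B) = \<nu> A + \<nu> B"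
proof -
  have "range (binaryset A B) \<subseteq> sets borel"
    using assms(2,3) by (simp add: range_binaryset_eq)
  moreover have "disjoint_family (binaryset A B)"
    using assms(4) by (auto simp: disjoint_family_on_def binaryset_def)
  ultimately have *: "(\<lambda>n. \<nu> (binaryset A B n)) sums \<nu> (A \<union> B)"
    using assms(1) unfolding borel_countably_additive_def UN_binaryset_eq[of A B, symmetric] by blast
  have "(\<lambda>n. \<nu> (binaryset A B n)) sums (\<nu> A + \<nu> B)"
    using borel_countably_additive_empty[OF assms(1)] by (intro binaryset_sums) auto
  with * show ?thesis by (rule sums_unique2)
qed

text \<open>The construction \<open>measure_of\<close> does not degenerate to the null measure here.\<close>

lemma emeasure_positive_variation:
  fixes \<nu> :: "'a::topological_space set \<Rightarrow> real"
  assumes \<nu>: "borel_countably_additive \<nu>" and A: "A \<in> sets borel"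
  shows "emeasure (positive_variation \<nu>) A = (SUP B\<in>{B \<in> sets borel. B \<subseteq> A}. ennreal (\<nu> B))"
proof -
  define s where "s A = (SUP B\<in>{B \<in> sets borel. B \<subseteq> A}. ennreal (\<nu> B))" for A
  have up: "ennreal (\<nu> B) \<le> s A" if "B \<in> sets borel" "B \<subseteq> A" for A B
    unfolding s_def using that by (intro SUP_upper) auto
  have "{B \<in> sets borel. B \<subseteq> ({}::'a set)} = {{}}" by auto
  then have s0: "s {} = 0"
    using borel_countably_additive_empty[OF \<nu>] unfolding s_def by simp
  have mono: "s A \<le> s B" if "A \<subseteq> B" for A B
    unfolding s_def using that by (intro SUP_subset_mono) auto
  have two: "ennreal (\<nu> C) + ennreal (\<nu> D) \<le> s (A \<union> B)"
    if "A \<inter> B = {}" "C \<in> sets borel" "C \<subseteq> A" "D \<in> sets borel" "D \<subseteq> B" for A B C D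
  proof (cases "\<nu> C \<ge> 0 \<and> \<nu> D \<ge> 0")
    case True
    have "\<nu> (C \<union> D) = \<nu> C + \<nu> D"
      using that by (intro borel_countably_additive_Un[OF \<nu>]) auto
    then have "ennreal (\<nu> C) + ennreal (\<nu> D) = ennreal (\<nu> (C \<union> D))"
      using True by simp
    also have "\<dots> \<le> s (A \<union> B)" using that by (intro up) auto
    finally show ?thesis .
  next
    case False
    have "ennreal (\<nu> C) \<le> s (A \<union> B)" "ennreal (\<nu> D) \<le> s (A \<union> B)"
      using that by (auto intro!: up)
    moreover have "ennreal (\<nu> C) = 0 \<or> ennreal (\<nu> D) = 0"
      using False by (metis ennreal_neg linear)
    ultimately show ?thesis by auto
  qed
  have super: "s A + s B \<le> s (A \<union> B)" if "A \<inter> B = {}" for A B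
  proof -
    have 1: "ennreal (\<nu> C) + s B \<le> s (A \<union> B)" if C: "C \<in> sets borel" "C \<subseteq> A" for C
    proof -
      have "ennreal (\<nu> C) + s B = (SUP D\<in>{D \<in> sets borel. D \<subseteq> B}. ennreal (\<nu> C) + ennreal (\<nu> D))"
        unfolding s_def by (rule ennreal_SUP_add_right) auto
      also have "\<dots> \<le> s (A \<union> B)"
        using two[OF \<open>A \<inter> B = {}\<close> C] by (intro SUP_least) auto
      finally show ?thesis .
    qed
    have "s A + s B = (SUP C\<in>{C \<in> sets borel. C \<subseteq> A}. ennreal (\<nu> C) + s B)"
      unfolding s_def[of A] by (rule ennreal_SUP_add_left[symmetric]) auto
    also have "\<dots> \<le> s (A \<union> B)" using 1 by (intro SUP_least) auto
    finally show ?thesis .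
  qed
  have "countably_additive (sets borel) s"
  proof (rule countably_additiveI)
    fix A :: "nat \<Rightarrow> 'a set"
    assume A: "range A \<subseteq> sets borel" "disjoint_family A"
    have fin: "(\<Sum>i<n. s (A i)) \<le> s (\<Union>i<n. A i)" for n
    proof (induction n)
      case (Suc n)
      have "(\<Union>i<n. A i) \<inter> A n = {}"
        using disjoint_family_onD[OF A(2), of _ n] by (blast dest: less_imp_neq)
      note super[OF this]
      moreover have "(\<Union>i<Suc n. A i) = (\<Union>i<n. A i) \<union> A n"
        by (auto simp: less_Suc_eq)
      ultimately show ?case
        using order_trans[OF add_right_mono[OF Suc, of "s (A n)"]] by simp
    qed (simp add: s0)
    show "(\<Sum>i. s (A i)) = s (\<Union>i. A i)"
    proof (rule antisym)
      show "(\<Sum>i. s (A i)) \<le> s (\<Union>i. A i)"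
        unfolding suminf_eq_SUP by (rule SUP_least, rule order_trans[OF fin], rule mono) auto
      have "ennreal (\<nu> B) \<le> (\<Sum>i. s (A i))" if B: "B \<in> sets borel" "B \<subseteq> (\<Union>i. A i)" for B
      proof -
        have "(\<lambda>n. \<nu> (B \<inter> A n)) sums \<nu> (\<Union>n. B \<inter> A n)"
          using \<nu>[unfolded borel_countably_additive_def, rule_format, of "\<lambda>n. B \<inter> A n"] A B(1)
          by (simp add: disjoint_family_on_def image_subset_iff del: UN_simps Int_UN_distrib) blast
        also have "(\<Union>n. B \<inter> A n) = B" using B by auto
        finally have "(\<lambda>n. ennreal (\<Sum>i<n. \<nu> (B \<inter> A i))) \<longlonglongrightarrow> ennreal (\<nu> B)"
          unfolding sums_def by (rule tendsto_ennrealI)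
        moreover have "ennreal (\<Sum>i<n. \<nu> (B \<inter> A i)) \<le> (\<Sum>i. s (A i))" for n
        proof -
          have "ennreal (\<Sum>i<n. \<nu> (B \<inter> A i)) \<le> ennreal (\<Sum>i<n. max 0 (\<nu> (B \<inter> A i)))"
            by (intro ennreal_leI sum_mono) auto
          also have "\<dots> = (\<Sum>i<n. ennreal (\<nu> (B \<inter> A i)))"
            by (subst sum_ennreal[symmetric]) (simp_all add: ennreal_max_0)
          also have "\<dots> \<le> (\<Sum>i<n. s (A i))"
            using A B(1) by (intro sum_mono up) auto
          also have "\<dots> \<le> (\<Sum>i. s (A i))" by (rule sum_le_suminf) auto
          finally show ?thesis .
        qed
        ultimately show ?thesis by (intro LIMSEQ_le_const2) auto
      qed
      then show "s (\<Union>i. A i) \<le> (\<Sum>i. s (A i))"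
        unfolding s_def[of "\<Union>i. A i"] by (intro SUP_least) auto
    qed
  qed
  moreover have "positive (sets borel) s" by (simp add: positive_def s0)
  moreover have "positive_variation \<nu> = measure_of UNIV (sets borel) s"
    unfolding positive_variation_def s_def ..
  ultimately have "emeasure (positive_variation \<nu>) A = s A"
    using A sets.sigma_sets_eq[of "borel :: 'a measure"] by (intro emeasure_measure_of) auto
  then show ?thesis unfolding s_def .
qed


section \<open>Arc length on finite disjoint unions of smooth curves\<close>

text \<open>A regular injective parametrization of class C-infinity (one-sided at endpoints in \<open>I\<close>).\<close>

definition smooth_parametrization :: "(real \<Rightarrow> real \<times> real) \<Rightarrow> real set \<Rightarrow> bool" where
  "smooth_parametrization \<gamma> I \<longleftrightarrow>
     is_interval I \<and> interior I \<noteq> {} \<and> inj_on \<gamma> I \<and>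
     (\<exists>D :: nat \<Rightarrow> real \<Rightarrow> real \<times> real.
        (\<forall>t\<in>I. D 0 t = \<gamma> t) \<and>
        (\<forall>k. \<forall>t\<in>I. (D k has_vector_derivative D (Suc k) t) (at t within I))) \<and>
     (\<forall>t\<in>I. vector_derivative \<gamma> (at t within I) \<noteq> 0)"

text \<open>The norm on \<open>real \<times> real\<close> is Euclidean, so this is the image of \<open>sqrt (x'\<^sup>2 + y'\<^sup>2) dt\<close>.\<close>

definition curve_arc_length :: "(real \<Rightarrow> real \<times> real) \<Rightarrow> real set \<Rightarrow> (real \<times> real) measure" where
  "curve_arc_length \<gamma> I =
     distr (density (restrict_space lborel I)
             (\<lambda>t. ennreal (norm (vector_derivative \<gamma> (at t within I)))))
       borel \<gamma>"

text \<open>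
  \<open>\<Gamma>\<close> is a finite disjoint union of smooth curves with arc length measure \<open>\<sigma>\<close>. By the change of
  variables formula \<open>\<sigma>\<close> does not depend on the chosen decomposition and parametrizations.
\<close>

definition arc_length_measure :: "(real \<times> real) set \<Rightarrow> (real \<times> real) measure \<Rightarrow> bool" where
  "arc_length_measure \<Gamma> \<sigma> \<longleftrightarrow>
     (\<exists>(n::nat) \<gamma> I.
        (\<forall>k<n. smooth_parametrization (\<gamma> k) (I k)) \<and>
        disjoint_family_on (\<lambda>k. \<gamma> k ` I k) {..<n} \<and>
        \<Gamma> = (\<Union>k<n. \<gamma> k ` I k) \<and>
        sets \<sigma> = sets borel \<and>
        (\<forall>A\<in>sets borel. emeasure \<sigma> A = (\<Sum>k<n. emeasure (curve_arc_length (\<gamma> k) (I k)) A)))"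


section \<open>Heisenberg uniqueness pairs\<close>

definition curve_measures :: "(real \<times> real) set \<Rightarrow> ((real \<times> real) set \<Rightarrow> complex) set" where
  "curve_measures \<Gamma> = {\<mu>. complex_borel_measure \<mu> \<and>
             (\<forall>A\<in>sets borel. A \<inter> \<Gamma> = {} \<longrightarrow> \<mu> A = 0) \<and>
             (\<exists>\<sigma>. arc_length_measure \<Gamma> \<sigma> \<and> (\<forall>A\<in>null_sets \<sigma>. \<mu> A = 0))}"

definition measure_fourier :: "((real \<times> real) set \<Rightarrow> complex) \<Rightarrow> real \<times> real \<Rightarrow> complex" where
  "measure_fourier \<mu> = (\<lambda>(\<xi>, \<eta>).
     complex_measure_integral \<mu>
       (\<lambda>(x, y). exp (- \<i> * of_real pi * of_real (x * \<xi> + y * \<eta>))))"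

text \<open>The first conjunct says that \<open>\<Gamma>\<close> is a finite disjoint union of smooth curves.\<close>

definition heisenberg_uniqueness_pair :: "(real \<times> real) set \<Rightarrow> (real \<times> real) set \<Rightarrow> bool" where
  "heisenberg_uniqueness_pair \<Gamma> \<Lambda> \<longleftrightarrow>
     (\<exists>\<sigma>. arc_length_measure \<Gamma> \<sigma>) \<and>
     (\<forall>\<mu>\<in>curve_measures \<Gamma>. (\<forall>p\<in>\<Lambda>. measure_fourier \<mu> p = 0) \<longrightarrow> (\<forall>A\<in>sets borel. \<mu> A = 0))"

definition line_parallel_to_X_axis :: "(real \<times> real) set \<Rightarrow> bool" where
  "line_parallel_to_X_axis L \<longleftrightarrow> (\<exists>p. L = {p + t *\<^sub>R (1, 0) | t. True})"

end

theory Submission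
  imports Defs "HOL-Probability.Levy"
begin

text \<open>
  If \<open>\<mu>\<close> has vanishing Fourier transform on the line \<open>\<eta> = \<eta>\<^sub>j\<close>, then the image under \<open>(x, y) \<mapsto> x\<close> of
  \<open>exp (- \<i> \<pi> \<eta>\<^sub>j y) d\<mu>\<close> has vanishing one-dimensional Fourier transform, so it is 0 by the uniqueness theorem.
  Hence \<open>\<mu>\<close> annihilates every bounded Borel function \<open>exp (- \<i> \<pi> \<eta>\<^sub>j y) h(x)\<close>. Only the two points \<open>(x, y)\<close>
  and \<open>(x, - y)\<close> of the hyperbola lie over a given \<open>x\<close>, so two such functions suffice to represent any bounded
  function on the part of the hyperbola where \<open>\<bar>sin (\<pi> (\<eta>\<^sub>2 - \<eta>\<^sub>1) y)\<bar>\<close> is bounded below. The zeros of the sine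
  give a countable subset of the hyperbola, which is a null set by absolute continuity.
\<close>

section \<open>Jordan decomposition\<close>

lemma borel_countably_additive_Diff:
  assumes "borel_countably_additive \<nu>" "A \<in> sets borel" "B \<in> sets borel" "B \<subseteq> A"
  shows "\<nu> (A - B) = \<nu> A - \<nu> B"
proof -
  have "\<nu> (B \<union> (A - B)) = \<nu> B + \<nu> (A - B)"
    by (rule borel_countably_additive_Un) (use assms in auto)
  moreover have "B \<union> (A - B) = A" using assms by auto
  ultimately show ?thesis by simp
qed

text \<open>Otherwise disjoint pieces of norm above 1 could be split off successively from a set
  whose Borel subsets take unbounded values. The series over these pieces would converge although
  its terms do not tend to 0.\<close>

lemma borel_countably_additive_bounded:
  assumes \<nu>: "borel_countably_additive \<nu>"
  obtains K where "\<And>B. B \<in> sets borel \<Longrightarrow> norm (\<nu> B) \<le> K"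
proof (rule ccontr)
  assume no: "\<not> thesis"
  define unb where "unb E \<longleftrightarrow> E \<in> sets borel \<and> (\<forall>K. \<exists>B\<in>sets borel. B \<subseteq> E \<and> norm (\<nu> B) > K)" for E
  have "\<exists>B\<in>sets borel. norm (\<nu> B) > K" for K
  proof (rule ccontr)
    assume "\<not> ?thesis"
    then have "\<And>B. B \<in> sets borel \<Longrightarrow> norm (\<nu> B) \<le> K" by (simp add: not_less)
    with no that show False by blast
  qed
  then have unbU: "unb UNIV" by (simp add: unb_def)
  have step: "\<exists>F. unb F \<and> F \<subseteq> E \<and> norm (\<nu> (E - F)) > 1" if E: "unb E" for E
  proof -
    have Eb: "E \<in> sets borel" using E by (simp add: unb_def)
    \<comment> \<open>The margin \<open>norm (\<nu> E) + 1\<close> forces norm above 1 on both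
      \<open>C\<close> and \<open>E - C\<close>, so either half may be split off and the unbounded
      one kept.\<close>
    obtain C where C: "C \<in> sets borel" "C \<subseteq> E" "norm (\<nu> C) > norm (\<nu> E) + 1"
      using E[unfolded unb_def, THEN conjunct2, rule_format, of "norm (\<nu> E) + 1"] by blast
    have EC: "\<nu> (E - C) = \<nu> E - \<nu> C"
      using borel_countably_additive_Diff[OF \<nu> Eb C(1,2)] .
    have nEC: "norm (\<nu> (E - C)) > 1"
      using C(3) norm_triangle_ineq2[of "\<nu> C" "\<nu> E"] unfolding EC by (simp add: norm_minus_commute)
    have EEC: "E - (E - C) = C" using C by auto
    have nC: "norm (\<nu> C) > 1" using C(3) norm_ge_zero[of "\<nu> E"] by linarith
    \<comment> \<open>\<open>C\<close> cuts every subset of \<open>E\<close> in two, so bounds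
      \<open>K\<close> and \<open>K'\<close> on the halves would give the bound
      \<open>K + K'\<close> on \<open>E\<close>.\<close>
    have "unb C \<or> unb (E - C)"
    proof (rule ccontr)
      assume "\<not> (unb C \<or> unb (E - C))"
      then have not: "\<not> unb C" "\<not> unb (E - C)" by simp_all
      obtain K where K: "\<And>B. B \<in> sets borel \<Longrightarrow> B \<subseteq> C \<Longrightarrow> norm (\<nu> B) \<le> K"
        using not(1) C(1) unfolding unb_def by (meson not_less)
      have "E - C \<in> sets borel" using Eb C(1) by simp
      then obtain K' where K': "\<And>B. B \<in> sets borel \<Longrightarrow> B \<subseteq> E - C \<Longrightarrow> norm (\<nu> B) \<le> K'"
        using not(2) unfolding unb_def by (meson not_less)
      obtain B where B: "B \<in> sets borel" "B \<subseteq> E" "norm (\<nu> B) > K + K'"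
        using E[unfolded unb_def, THEN conjunct2, rule_format, of "K + K'"] by blast
      have "\<nu> ((B \<inter> C) \<union> (B - C)) = \<nu> (B \<inter> C) + \<nu> (B - C)"
        by (rule borel_countably_additive_Un[OF \<nu>]) (use B C in auto)
      moreover have "(B \<inter> C) \<union> (B - C) = B" by auto
      moreover have "norm (\<nu> (B \<inter> C)) \<le> K" by (rule K) (use B C in auto)
      moreover have "norm (\<nu> (B - C)) \<le> K'" by (rule K') (use B C in auto)
      ultimately show False using B(3) norm_triangle_ineq[of "\<nu> (B \<inter> C)" "\<nu> (B - C)"] by simp
    qed
    then show ?thesis
    proof
      assume "unb C" then show ?thesis using nEC C(2) by blast
    next
      assume "unb (E - C)" then show ?thesis using nC EEC by (intro exI[of _ "E - C"]) auto
    qed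
  qed
  have "\<exists>F. \<forall>n::nat. unb (F n) \<and> F (Suc n) \<subseteq> F n \<and> norm (\<nu> (F n - F (Suc n))) > 1"
    by (rule dependent_nat_choice) (use unbU step in blast)+
  then obtain F where F: "\<And>n::nat. unb (F n)" "\<And>n. F (Suc n) \<subseteq> F n" "\<And>n. norm (\<nu> (F n - F (Suc n))) > 1"
    by auto
  have dec: "F n \<subseteq> F m" if "m \<le> n" for m n
    using that by (rule lift_Suc_antimono_le[of F, OF F(2)])
  have "disjoint_family (\<lambda>n. F n - F (Suc n))"
    unfolding disjoint_family_on_def
  proof (intro ballI impI)
    fix m n :: nat assume "m \<noteq> n"
    then have "Suc m \<le> n \<or> Suc n \<le> m" by auto
    then show "(F m - F (Suc m)) \<inter> (F n - F (Suc n)) = {}" using dec by blast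
  qed
  then have "(\<lambda>n. \<nu> (F n - F (Suc n))) sums \<nu> (\<Union>n. F n - F (Suc n))"
    using F(1) unfolding unb_def
    by (intro \<nu>[unfolded borel_countably_additive_def, rule_format]) auto
  then have "(\<lambda>n. \<nu> (F n - F (Suc n))) \<longlonglongrightarrow> 0"
    by (intro summable_LIMSEQ_zero sums_summable)
  then have "eventually (\<lambda>n. norm (\<nu> (F n - F (Suc n))) < 1) sequentially"
    using order_tendstoD(2)[OF tendsto_norm_zero] zero_less_one by blast
  then obtain n where "norm (\<nu> (F n - F (Suc n))) < 1"
    by (auto simp: eventually_sequentially)
  with F(3)[of n] show False by simp
qed

lemma sets_positive_variation [measurable_cong, simp]: "sets (positive_variation \<nu>) = sets borel"
  unfolding positive_variation_def using sets.sigma_sets_eq[of borel] by (simp add: sets_measure_of)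

lemma space_positive_variation [simp]: "space (positive_variation \<nu>) = UNIV"
  unfolding positive_variation_def by (simp add: space_measure_of)

lemma borel_countably_additive_uminus:
  "borel_countably_additive \<nu> \<Longrightarrow> borel_countably_additive (\<lambda>A. - \<nu> A)"
  unfolding borel_countably_additive_def using sums_minus by blast

lemma finite_measure_positive_variation:
  assumes \<nu>: "borel_countably_additive \<nu>"
  shows "finite_measure (positive_variation \<nu>)"
proof
  obtain K where K: "\<And>B. B \<in> sets borel \<Longrightarrow> norm (\<nu> B) \<le> K"
    using borel_countably_additive_bounded[OF \<nu>] by blast
  have "\<nu> B \<le> K" if "B \<in> sets borel" for B
    using K[OF that] by simp
  then have "emeasure (positive_variation \<nu>) UNIV \<le> ennreal K"
    by (subst emeasure_positive_variation[OF \<nu>]) (auto intro!: SUP_least ennreal_leI)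
  then show "emeasure (positive_variation \<nu>) (space (positive_variation \<nu>)) \<noteq> \<infinity>"
    by (auto simp: top_unique)
qed

text \<open>For Borel \<open>B \<subseteq> A\<close>,
  \<open>\<nu> B = \<nu> A - \<nu> (A - B)\<close>, and \<open>- \<nu> (A - B)\<close> is at most
  the negative variation of \<open>A\<close>. The supremum over \<open>B\<close> gives one
  inequality, the same argument for \<open>- \<nu>\<close> the other.\<close>

lemma Jordan_decomposition:
  assumes \<nu>: "borel_countably_additive \<nu>" and A: "A \<in> sets borel"
  shows "\<nu> A = measure (positive_variation \<nu>) A - measure (positive_variation (\<lambda>A. - \<nu> A)) A"
proof -
  have upper: "\<nu> B \<le> measure (positive_variation \<nu>) A"
    if \<nu>: "borel_countably_additive \<nu>" and "B \<in> sets borel" "B \<subseteq> A" for B \<nu>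
  proof -
    interpret finite_measure "positive_variation \<nu>" by (rule finite_measure_positive_variation[OF \<nu>])
    have "ennreal (\<nu> B) \<le> emeasure (positive_variation \<nu>) A"
      by (subst emeasure_positive_variation[OF \<nu> A]) (use that in \<open>auto intro!: SUP_upper\<close>)
    then show ?thesis by (simp add: emeasure_eq_measure)
  qed
  have least: "measure (positive_variation \<nu>) A \<le> c"
    if \<nu>: "borel_countably_additive \<nu>" and *: "\<And>B. B \<in> sets borel \<Longrightarrow> B \<subseteq> A \<Longrightarrow> \<nu> B \<le> c" for c \<nu>
  proof -
    interpret finite_measure "positive_variation \<nu>" by (rule finite_measure_positive_variation[OF \<nu>])
    \<comment> \<open>Nonnegativity of \<open>c\<close> keeps \<open>ennreal c\<close> from
      truncating, so the bound can be read back in the reals.\<close>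
    have "0 \<le> c" using *[of "{}"] borel_countably_additive_empty[OF \<nu>] by simp
    have "emeasure (positive_variation \<nu>) A \<le> ennreal c"
      by (subst emeasure_positive_variation[OF \<nu> A]) (use * in \<open>auto intro!: SUP_least ennreal_leI\<close>)
    then show ?thesis using \<open>0 \<le> c\<close> by (simp add: emeasure_eq_measure)
  qed
  have half: "measure (positive_variation \<nu>) A \<le> \<nu> A + measure (positive_variation (\<lambda>A. - \<nu> A)) A"
    if \<nu>: "borel_countably_additive \<nu>" for \<nu>
  proof (rule least[OF \<nu>])
    fix B assume B: "B \<in> sets borel" "B \<subseteq> A"
    have "- \<nu> (A - B) \<le> measure (positive_variation (\<lambda>A. - \<nu> A)) A"
      by (rule upper[OF borel_countably_additive_uminus[OF \<nu>]]) (use A B in auto)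
    then show "\<nu> B \<le> \<nu> A + measure (positive_variation (\<lambda>A. - \<nu> A)) A"
      using borel_countably_additive_Diff[OF \<nu> A B] by simp
  qed
  from half[OF \<nu>] half[OF borel_countably_additive_uminus[OF \<nu>]] show ?thesis by simp
qed

section \<open>Integration against complex measures\<close>

text \<open>Reduces claims about bounded Borel functions to indicators by way of simple functions.
  The approximating sequence is dominated by \<open>2 * norm (f x)\<close>, so the limit case may
  assume a uniform bound, as dominated convergence requires.\<close>

lemma bounded_borel_induct [consumes 2, case_names indicator mult add lim]:
  fixes f :: "'a::topological_space \<Rightarrow> complex"
  assumes f: "f \<in> borel_measurable borel" "\<And>x. norm (f x) \<le> K"
    and indicator: "\<And>A. A \<in> sets borel \<Longrightarrow> P (indicator A)"
    and mult: "\<And>c f. f \<in> borel_measurable borel \<Longrightarrow> bounded (range f) \<Longrightarrow> P f \<Longrightarrow> P (\<lambda>x. c * f x)"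
    and add: "\<And>f g. f \<in> borel_measurable borel \<Longrightarrow> bounded (range f) \<Longrightarrow> P f \<Longrightarrow>
      g \<in> borel_measurable borel \<Longrightarrow> bounded (range g) \<Longrightarrow> P g \<Longrightarrow> P (\<lambda>x. f x + g x)"
    and lim: "\<And>s f K. f \<in> borel_measurable borel \<Longrightarrow> (\<And>n. s n \<in> borel_measurable borel) \<Longrightarrow>
      (\<And>n x. norm (s n x) \<le> K) \<Longrightarrow>
      (\<And>n. P (s n)) \<Longrightarrow> (\<And>x. (\<lambda>n. s n x) \<longlonglongrightarrow> f x) \<Longrightarrow> P f"
  shows "P f"
proof -
  obtain s where s: "\<And>i. simple_function borel (s i)" "\<And>x. (\<lambda>i. s i x) \<longlonglongrightarrow> f x"
    "\<And>i x. norm (s i x) \<le> 2 * norm (f x)"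
    using borel_measurable_implies_sequence_metric[OF f(1), of 0] by (auto simp: space_borel)
  have bi: "bounded (range (\<lambda>x. c * indicator A x :: complex))" for c :: complex and A :: "'a set"
    by (rule boundedI[of _ "norm c"]) (auto simp: indicator_def)
  have simple: "P g" if g: "simple_function borel g" for g :: "'a \<Rightarrow> complex"
  proof -
    have fin: "finite (range g)" and ms: "\<And>y. g -` {y} \<in> sets borel"
      using simple_functionD[OF g] by (simp_all add: space_borel)
    \<comment> \<open>Boundedness is carried along because the sum case asks for bounded
      summands.\<close>
    have gen: "P (\<lambda>x. \<Sum>y\<in>S. y * indicator (g -` {y}) x) \<and> bounded (range (\<lambda>x. \<Sum>y\<in>S. y * indicator (g -` {y}) x))"
      if "finite S" for S
      using that
    proof (induction S)
      case empty
      have "(\<lambda>x. 0) = (indicator {} :: 'a \<Rightarrow> complex)" by auto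
      then show ?case using indicator[of "{}"] by simp
    next
      case (insert z S)
      have "P (\<lambda>x. z * indicator (g -` {z}) x)"
        by (rule mult) (use ms bi[of 1] in \<open>auto intro!: indicator\<close>)
      then have "P (\<lambda>x. z * indicator (g -` {z}) x + (\<Sum>y\<in>S. y * indicator (g -` {y}) x))"
        by (intro add bi borel_measurable_sum borel_measurable_times borel_measurable_const borel_measurable_indicator ms)
          (use insert in blast)+
      moreover have "bounded (range (\<lambda>x. z * indicator (g -` {z}) x + (\<Sum>y\<in>S. y * indicator (g -` {y}) x)))"
        by (rule bounded_plus_comp[OF bi]) (use insert in simp)
      ultimately show ?case unfolding sum.insert[OF insert.hyps] ..
    qed
    have "(\<Sum>y\<in>range g. y * indicator (g -` {y}) x) = g x" for x
    proof -
      have "(\<Sum>y\<in>range g. y * indicator (g -` {y}) x) = (\<Sum>y\<in>range g. if y = g x then y else 0)"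
        by (intro sum.cong) (auto simp: indicator_def)
      then show ?thesis using fin by simp
    qed
    then show ?thesis using gen[OF fin] by simp
  qed
  show ?thesis
  proof (rule lim[of f s "2 * K"])
    show "s i \<in> borel_measurable borel" for i using s(1) by (rule borel_measurable_simple_function)
    show "norm (s i x) \<le> 2 * K" for i x using s(3)[of i x] f(2)[of x] by linarith
  qed (use s f simple in auto)
qed

section \<open>Linearity, dominated convergence and null sets of the complex integral\<close>

lemma integrable_positive_variation:
  fixes f :: "'a::topological_space \<Rightarrow> complex"
  assumes \<nu>: "borel_countably_additive \<nu>" and f: "f \<in> borel_measurable borel" "bounded (range f)"
  shows "integrable (positive_variation \<nu>) f"
proof -
  interpret finite_measure "positive_variation \<nu>" by (rule finite_measure_positive_variation[OF \<nu>])
  obtain K where "\<And>x. norm (f x) \<le> K" using f(2) by (auto simp: bounded_iff)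
  then show ?thesis using f(1) by (intro integrable_const_bound[of _ K]) auto
qed

lemma complex_borel_measure_parts:
  assumes "complex_borel_measure \<mu>"
  shows "borel_countably_additive (\<lambda>A. Re (\<mu> A))" "borel_countably_additive (\<lambda>A. - Re (\<mu> A))"
    "borel_countably_additive (\<lambda>A. Im (\<mu> A))" "borel_countably_additive (\<lambda>A. - Im (\<mu> A))"
  using assms unfolding complex_borel_measure_def borel_countably_additive_def
  by (auto intro!: sums_Re sums_Im sums_minus)

context
  fixes \<mu> :: "'a::topological_space set \<Rightarrow> complex"
  assumes \<mu>: "complex_borel_measure \<mu>"
begin

lemma complex_measure_integral_add:
  assumes "f \<in> borel_measurable borel" "bounded (range f)" "g \<in> borel_measurable borel" "bounded (range g)"
  shows "complex_measure_integral \<mu> (\<lambda>x. f x + g x) = complex_measure_integral \<mu> f + complex_measure_integral \<mu> g"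
  unfolding complex_measure_integral_def
  using complex_borel_measure_parts[OF \<mu>] assms
  by (simp add: integrable_positive_variation algebra_simps)

lemma complex_measure_integral_mult:
  "complex_measure_integral \<mu> (\<lambda>x. c * f x) = c * complex_measure_integral \<mu> f"
  unfolding complex_measure_integral_def by (simp add: algebra_simps)

lemma complex_measure_integral_sum:
  assumes "finite S" "\<And>i. i \<in> S \<Longrightarrow> f i \<in> borel_measurable borel" "\<And>i. i \<in> S \<Longrightarrow> bounded (range (f i))"
  shows "complex_measure_integral \<mu> (\<lambda>x. \<Sum>i\<in>S. f i x) = (\<Sum>i\<in>S. complex_measure_integral \<mu> (f i))"
  unfolding complex_measure_integral_def
  using complex_borel_measure_parts[OF \<mu>] assms
  by (simp add: integrable_positive_variation right_diff_distrib sum_distrib_left sum.distrib sum_subtractf)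

text \<open>The variations are finite measures, so the constant \<open>K\<close> is an integrable
  majorant in each of the four integrals.\<close>

lemma complex_measure_integral_lim:
  assumes f: "f \<in> borel_measurable borel" and s: "\<And>n. s n \<in> borel_measurable borel"
    and K: "\<And>n x. norm (s n x) \<le> K" and lim: "\<And>x. (\<lambda>n. s n x) \<longlonglongrightarrow> f x"
  shows "(\<lambda>n. complex_measure_integral \<mu> (s n)) \<longlonglongrightarrow> complex_measure_integral \<mu> f"
proof -
  have "(\<lambda>n. LINT x|positive_variation \<nu>. s n x) \<longlonglongrightarrow> (LINT x|positive_variation \<nu>. f x)"
    if \<nu>: "borel_countably_additive \<nu>" for \<nu> :: "'a set \<Rightarrow> real"
  proof -
    interpret finite_measure "positive_variation \<nu>" by (rule finite_measure_positive_variation[OF \<nu>])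
    show ?thesis
      by (rule integral_dominated_convergence[where w = "\<lambda>_. K"]) (use f s K lim in auto)
  qed
  then show ?thesis
    unfolding complex_measure_integral_def
    by (intro tendsto_intros) (use complex_borel_measure_parts[OF \<mu>] in auto)
qed

text \<open>The four integrals are the variations of \<open>A\<close>, and the Jordan decomposition
  recombines them into \<open>Re (\<mu> A)\<close> and \<open>Im (\<mu> A)\<close>.\<close>

lemma complex_measure_integral_indicator:
  assumes A: "A \<in> sets borel"
  shows "complex_measure_integral \<mu> (indicator A) = \<mu> A"
proof -
  have *: "(LINT x|positive_variation \<nu>. indicator A x :: complex) = of_real (measure (positive_variation \<nu>) A)"
    if \<nu>: "borel_countably_additive \<nu>" for \<nu> :: "'a set \<Rightarrow> real"
  proof -
    interpret finite_measure "positive_variation \<nu>" by (rule finite_measure_positive_variation[OF \<nu>])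
    have "(indicator A :: 'a \<Rightarrow> complex) = (\<lambda>x. of_real (indicator A x))"
      by (auto simp: indicator_def)
    then show ?thesis using A by (simp add: integral_complex_of_real)
  qed
  note parts = complex_borel_measure_parts[OF \<mu>]
  show ?thesis
    unfolding complex_measure_integral_def *[OF parts(1)] *[OF parts(2)] *[OF parts(3)] *[OF parts(4)]
    using Jordan_decomposition[OF parts(1) A] Jordan_decomposition[OF parts(3) A]
    by (simp add: complex_eq_iff)
qed

text \<open>All Borel subsets of the complement of \<open>\<Gamma>\<close> have value 0, so the
  suprema defining the four variations vanish there, and \<open>f\<close> and \<open>g\<close> agree
  almost everywhere.\<close>

lemma complex_measure_integral_cong_on:
  assumes \<Gamma>: "\<Gamma> \<in> sets borel" and null: "\<And>A. A \<in> sets borel \<Longrightarrow> A \<inter> \<Gamma> = {} \<Longrightarrow> \<mu> A = 0"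
    and f: "f \<in> borel_measurable borel" and g: "g \<in> borel_measurable borel"
    and eq: "\<And>x. x \<in> \<Gamma> \<Longrightarrow> f x = g x"
  shows "complex_measure_integral \<mu> f = complex_measure_integral \<mu> g"
proof -
  have *: "(LINT x|positive_variation \<nu>. f x) = (LINT x|positive_variation \<nu>. g x)"
    if \<nu>: "borel_countably_additive \<nu>" and n: "\<And>A. A \<in> sets borel \<Longrightarrow> A \<inter> \<Gamma> = {} \<Longrightarrow> \<nu> A = 0"
    for \<nu> :: "'a set \<Rightarrow> real"
  proof (rule integral_cong_AE)
    have "\<nu> B = 0" if "B \<in> sets borel" "B \<subseteq> - \<Gamma>" for B
      by (rule n) (use that in auto)
    then have "emeasure (positive_variation \<nu>) (- \<Gamma>) \<le> 0"
      by (subst emeasure_positive_variation[OF \<nu>]) (use \<Gamma> in simp, intro SUP_least, simp)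
    then have "- \<Gamma> \<in> null_sets (positive_variation \<nu>)" using \<Gamma> by auto
    then show "AE x in positive_variation \<nu>. f x = g x"
      by (rule AE_I') (use eq in auto)
  qed (use f g in auto)
  show ?thesis
    unfolding complex_measure_integral_def
    using complex_borel_measure_parts[OF \<mu>] null by (simp add: *)
qed

end

lemma complex_measure_integral_null:
  assumes \<mu>: "complex_borel_measure \<mu>" and null: "\<And>A. A \<in> sets borel \<Longrightarrow> \<mu> A = 0"
    and f: "f \<in> borel_measurable borel"
  shows "complex_measure_integral \<mu> f = 0"
proof -
  \<comment> \<open>\<open>\<mu>\<close> lives on the empty set, so any two Borel functions have the
    same integral.\<close>
  have "complex_measure_integral \<mu> f = complex_measure_integral \<mu> (\<lambda>x. 0 * f x)"
    by (rule complex_measure_integral_cong_on[OF \<mu>, of "{}"]) (use null f in auto)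
  also have "\<dots> = 0" unfolding complex_measure_integral_mult[OF \<mu>] by simp
  finally show ?thesis .
qed

section \<open>Weighted images of complex measures\<close>

text \<open>The push-forward under \<open>p\<close> of the measure with density \<open>w\<close>
  relative to \<open>\<mu>\<close>.\<close>

definition weighted_image ::
    "('a::topological_space set \<Rightarrow> complex) \<Rightarrow> ('a \<Rightarrow> complex) \<Rightarrow> ('a \<Rightarrow> 'b) \<Rightarrow> 'b set \<Rightarrow> complex" where
  "weighted_image \<mu> w p B = complex_measure_integral \<mu> (\<lambda>x. w x * indicator B (p x))"

context
  fixes \<mu> :: "'a::topological_space set \<Rightarrow> complex" and w :: "'a \<Rightarrow> complex"
    and p :: "'a \<Rightarrow> 'b::topological_space" and C :: real
  assumes \<mu>: "complex_borel_measure \<mu>"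
    and w [measurable]: "w \<in> borel_measurable borel" and C: "\<And>x. norm (w x) \<le> C"
    and p [measurable]: "p \<in> borel_measurable borel"
begin

lemma weight_mult_bound: "norm (h (p x)) \<le> K \<Longrightarrow> norm (w x * h (p x)) \<le> C * K"
  unfolding norm_mult using C[of x] by (intro mult_mono order_trans[OF norm_ge_zero]) auto

lemma bounded_weight_mult: "bounded (range h) \<Longrightarrow> bounded (range (\<lambda>x. w x * h (p x)))"
  using weight_mult_bound unfolding bounded_iff by blast

text \<open>Linearity on disjoint indicators gives finite additivity; since \<open>w\<close> is
  bounded, dominated convergence along the partial unions makes it countable.\<close>

lemma complex_borel_measure_weighted_image: "complex_borel_measure (weighted_image \<mu> w p)"
  unfolding complex_borel_measure_def borel_countably_additive_def
proof (intro allI impI, elim conjE)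
  fix A :: "nat \<Rightarrow> 'b set" assume "range A \<subseteq> sets borel" and dis: "disjoint_family A"
  then have A [measurable]: "A n \<in> sets borel" for n by auto
  have 1: "weighted_image \<mu> w p (\<Union>i<n. A i) = (\<Sum>i<n. weighted_image \<mu> w p (A i))" for n
  proof -
    have "(\<Sum>i<n. weighted_image \<mu> w p (A i)) = complex_measure_integral \<mu> (\<lambda>x. \<Sum>i<n. w x * indicator (A i) (p x))"
      unfolding weighted_image_def
      by (rule complex_measure_integral_sum[OF \<mu>, symmetric])
        (auto intro: bounded_weight_mult[OF boundedI[of _ 1]] simp: indicator_def)
    moreover have "disjoint_family_on A {..<n}"
      using dis by (auto simp: disjoint_family_on_def)
    ultimately show ?thesis
      unfolding weighted_image_def by (simp add: indicator_UN_disjoint sum_distrib_left)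
  qed
  have "(\<lambda>n. weighted_image \<mu> w p (\<Union>i<n. A i)) \<longlonglongrightarrow> weighted_image \<mu> w p (\<Union>i. A i)"
    unfolding weighted_image_def
  proof (rule complex_measure_integral_lim[OF \<mu>])
    show "norm (w x * indicator (\<Union>i<n. A i) (p x)) \<le> C * 1" for n x
      by (rule weight_mult_bound) (auto simp: indicator_def)
    show "(\<lambda>n. w x * indicator (\<Union>i<n. A i) (p x)) \<longlonglongrightarrow> w x * indicator (\<Union>i. A i) (p x)" for x
      by (intro tendsto_mult tendsto_const LIMSEQ_indicator_UN)
    have *: "(\<lambda>x. w x * indicator B (p x)) \<in> borel_measurable borel" if "B \<in> sets borel" for B
      using that by measurable
    show "(\<lambda>x. w x * indicator (\<Union>i. A i) (p x)) \<in> borel_measurable borel"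
      "(\<lambda>x. w x * indicator (\<Union>i<n. A i) (p x)) \<in> borel_measurable borel" for n
      by (rule *, use A in auto)+
  qed
  then show "(\<lambda>n. weighted_image \<mu> w p (A n)) sums weighted_image \<mu> w p (\<Union>n. A n)"
    unfolding sums_def 1 .
qed

text \<open>For indicators this is the definition of \<open>weighted_image\<close>; both sides are
  linear in \<open>h\<close> and respect bounded pointwise limits.\<close>

lemma complex_measure_integral_weighted_image:
  assumes "h \<in> borel_measurable borel" "\<And>x. norm (h x) \<le> K"
  shows "complex_measure_integral (weighted_image \<mu> w p) h = complex_measure_integral \<mu> (\<lambda>x. w x * h (p x))"
  using assms
proof (induction h rule: bounded_borel_induct)
  case (indicator A)
  then show ?case
    by (subst complex_measure_integral_indicator[OF complex_borel_measure_weighted_image])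
      (simp_all add: weighted_image_def)
next
  case (mult c f)
  have "(\<lambda>x. w x * (c * f (p x))) = (\<lambda>x. c * (w x * f (p x)))" by (simp add: mult_ac)
  then show ?case
    using mult complex_measure_integral_mult[OF \<mu>]
      complex_measure_integral_mult[OF complex_borel_measure_weighted_image] by simp
next
  case (add f g)
  then have [measurable]: "f \<in> borel_measurable borel" "g \<in> borel_measurable borel" by simp_all
  have "complex_measure_integral \<mu> (\<lambda>x. w x * f (p x) + w x * g (p x))
      = complex_measure_integral \<mu> (\<lambda>x. w x * f (p x)) + complex_measure_integral \<mu> (\<lambda>x. w x * g (p x))"
    by (rule complex_measure_integral_add[OF \<mu>]) (use add in \<open>auto intro: bounded_weight_mult\<close>)
  then show ?case
    using add complex_measure_integral_add[OF complex_borel_measure_weighted_image, of f g]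
    by (simp add: distrib_left)
next
  case (lim s f K)
  note [measurable] = lim(1,2)
  have "(\<lambda>n. complex_measure_integral (weighted_image \<mu> w p) (s n))
      \<longlonglongrightarrow> complex_measure_integral (weighted_image \<mu> w p) f"
    by (rule complex_measure_integral_lim[OF complex_borel_measure_weighted_image]) (use lim in auto)
  moreover have "(\<lambda>n. complex_measure_integral \<mu> (\<lambda>x. w x * s n (p x)))
      \<longlonglongrightarrow> complex_measure_integral \<mu> (\<lambda>x. w x * f (p x))"
  proof (rule complex_measure_integral_lim[OF \<mu>])
    show "norm (w x * s n (p x)) \<le> C * K" for n x
      by (rule weight_mult_bound) (rule lim)
  qed (use lim in \<open>auto intro!: tendsto_intros\<close>)
  ultimately show ?case unfolding lim by (rule LIMSEQ_unique)
qed

end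

section \<open>Uniqueness of the Fourier transform\<close>

text \<open>\<open>char\<close> at 0 is the total mass, so both measures have the same mass
  \<open>m\<close>. Division by \<open>m\<close> leads to \<open>Levy_uniqueness\<close> for
  probability distributions; if \<open>m = 0\<close>, both measures vanish.\<close>

lemma finite_measure_eq_of_char:
  assumes M: "finite_measure M" "sets M = sets borel" and N: "finite_measure N" "sets N = sets borel"
    and char: "char M = char N"
  shows "M = N"
proof -
  interpret M: finite_measure M by fact
  interpret N: finite_measure N by fact
  note [measurable_cong] = M(2) N(2)
  have sp [simp]: "space M = UNIV" "space N = UNIV"
    using sets_eq_imp_space_eq[OF M(2)] sets_eq_imp_space_eq[OF N(2)] by simp_all
  define m where "m = measure M UNIV"
  have "char M 0 = char N 0" using char by simp
  then have m: "measure N UNIV = m" by (simp add: char_def m_def)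
  show ?thesis
  proof (cases "m = 0")
    case True
    have "emeasure M A = 0" "emeasure N A = 0" for A
      using emeasure_space[of M A] emeasure_space[of N A] m True
      by (simp_all add: M.emeasure_eq_measure N.emeasure_eq_measure m_def measure_le_0_iff)
    then show ?thesis using M(2) N(2) by (intro measure_eqI) auto
  next
    case False
    then have m0: "m > 0" by (simp add: m_def less_le)
    define scale where "scale P = density P (\<lambda>_. ennreal (1 / m))" for P :: "real measure"
    have em: "emeasure (scale P) A = ennreal (1 / m) * emeasure P A" if "A \<in> sets P" for P A
      unfolding scale_def using that by (simp add: emeasure_density_const)
    have char_scale: "char (scale P) t = char P t / m" if [measurable_cong]: "sets P = sets borel" for P t
      unfolding char_def scale_def using m0 by (subst integral_density) (auto simp: scaleR_conv_of_real)
    have rd: "real_distribution (scale P)"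
      if "finite_measure P" "sets P = sets borel" "measure P UNIV = m" for P
    proof -
      interpret P: finite_measure P by fact
      have "UNIV \<in> sets P" using that by simp
      then have "emeasure (scale P) UNIV = ennreal (1 / m) * ennreal m"
        by (simp add: em P.emeasure_eq_measure that)
      also have "\<dots> = 1" using m0 by (simp flip: ennreal_mult)
      finally have "emeasure (scale P) UNIV = 1" .
      moreover have "space (scale P) = UNIV"
        using sets_eq_imp_space_eq[OF that(2)] by (simp add: scale_def)
      ultimately have "prob_space (scale P)" by (intro prob_spaceI) simp
      then show ?thesis
        using that by (auto simp: real_distribution_def real_distribution_axioms_def scale_def)
    qed
    have "scale M = scale N"
      by (rule Levy_uniqueness) (use rd M N m char in \<open>auto simp: m_def char_scale fun_eq_iff\<close>)
    then have "ennreal (1 / m) * emeasure M A = ennreal (1 / m) * emeasure N A" if "A \<in> sets borel" for A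
      using em[of A M] em[of A N] that M(2) N(2) by simp
    then have "emeasure M A = emeasure N A" if "A \<in> sets borel" for A
      using that m0 by (simp add: ennreal_mult_cancel_left)
    then show ?thesis using M(2) N(2) by (intro measure_eqI) auto
  qed
qed

lemma char_uminus: "char M (- t) = cnj (char M t)"
proof -
  have "iexp (- t * x) = cnj (iexp (t * x))" for x by (simp add: exp_cnj)
  then show ?thesis unfolding char_def by (simp only: Bochner_Integration.integral_cnj)
qed

text \<open>The transforms of the real and the imaginary part of \<open>\<nu>\<close> both vanish.
  Hence the positive and negative variation of each part have the same \<open>char\<close>,
  coincide, and cancel in the Jordan decomposition.\<close>

lemma complex_measure_eq_0_if_char_eq_0:
  fixes \<nu> :: "real set \<Rightarrow> complex"
  assumes \<nu>: "complex_borel_measure \<nu>"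
    and char: "\<And>t. complex_measure_integral \<nu> (\<lambda>x. iexp (t * x)) = 0"
    and B: "B \<in> sets borel"
  shows "\<nu> B = 0"
proof -
  note parts = complex_borel_measure_parts[OF \<nu>]
  define a where "a = positive_variation (\<lambda>A. Re (\<nu> A))"
  define b where "b = positive_variation (\<lambda>A. - Re (\<nu> A))"
  define c where "c = positive_variation (\<lambda>A. Im (\<nu> A))"
  define d where "d = positive_variation (\<lambda>A. - Im (\<nu> A))"
  have eq: "(char a t - char b t) + \<i> * (char c t - char d t) = 0" for t
    using char[of t] unfolding complex_measure_integral_def char_def a_def b_def c_def d_def by simp
  \<comment> \<open>The variations are positive measures, so conjugating the equation at
    \<open>- t\<close> restores the differences of \<open>char\<close> at \<open>t\<close> and only
    flips the sign of \<open>\<i>\<close>.\<close>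
  have conj: "(char a t - char b t) - \<i> * (char c t - char d t) = 0" for t
    using arg_cong[OF eq[of "- t"], of cnj] by (simp add: char_uminus)
  have "char a t - char b t = 0" "char c t - char d t = 0" for t
    using eq[of t] conj[of t] by (simp_all add: complex_eq_iff)
  then have "char a = char b" "char c = char d" by auto
  then have "a = b" "c = d"
    unfolding a_def b_def c_def d_def using parts
    by (auto intro!: finite_measure_eq_of_char finite_measure_positive_variation)
  then show ?thesis
    using Jordan_decomposition[OF parts(1) B] Jordan_decomposition[OF parts(3) B]
    unfolding a_def b_def c_def d_def by (simp add: complex_eq_iff)
qed

section \<open>Arc length\<close>

text \<open>On \<open>I\<close> both \<open>\<gamma>\<close> and its derivative agree with members
  of the differentiable family \<open>D\<close>, so they are continuous there.\<close>

lemma smooth_parametrization_measurable: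
  assumes "smooth_parametrization \<gamma> I"
  shows "I \<in> sets borel" "\<gamma> \<in> measurable (restrict_space lborel I) borel"
    "(\<lambda>t. norm (vector_derivative \<gamma> (at t within I))) \<in> borel_measurable (restrict_space lborel I)"
proof -
  obtain D where D: "\<And>t. t \<in> I \<Longrightarrow> D 0 t = \<gamma> t"
    "\<And>k t. t \<in> I \<Longrightarrow> (D k has_vector_derivative D (Suc k) t) (at t within I)"
    using assms unfolding smooth_parametrization_def by blast
  have I: "is_interval I" "interior I \<noteq> {}" using assms by (auto simp: smooth_parametrization_def)
  show "I \<in> sets borel" using I(1) by (rule real_interval_borel_measurable)
  \<comment> \<open>Once one-point intervals are excluded, every point of \<open>I\<close> is a
    limit point, and the derivative within \<open>I\<close> is unique even at endpoints.\<close>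
  have "I \<noteq> {x}" for x using I(2) by auto
  then have nb: "at t within I \<noteq> bot" if "t \<in> I" for t
    using connected_imp_perfect[of I t] that I(1) by (simp add: is_interval_connected trivial_limit_within)
  have cont: "continuous_on I (D k)" for k
    unfolding continuous_on_eq_continuous_within using D(2) has_vector_derivative_continuous by blast
  have meas: "f \<in> measurable (restrict_space lborel I) borel" if "continuous_on I f"
    for f :: "real \<Rightarrow> 'c::topological_space"
  proof -
    have "sets (restrict_space lborel I) = sets (restrict_space borel I)"
      by (rule sets_restrict_space_cong) simp
    with borel_measurable_continuous_on_restrict[OF that] show ?thesis
      by (simp cong: measurable_cong_sets)
  qed
  show "\<gamma> \<in> measurable (restrict_space lborel I) borel"
    by (rule meas) (use cont[of 0] D(1) in \<open>simp cong: continuous_on_cong\<close>)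
  have "vector_derivative \<gamma> (at t within I) = D 1 t" if "t \<in> I" for t
    using D that nb
    by (intro vector_derivative_within has_vector_derivative_transform[of t I \<gamma> "D 0"]) auto
  then have "continuous_on I (\<lambda>t. norm (vector_derivative \<gamma> (at t within I)))"
    using continuous_on_norm[OF cont[of 1]] by (simp cong: continuous_on_cong)
  then show "(\<lambda>t. norm (vector_derivative \<gamma> (at t within I))) \<in> borel_measurable (restrict_space lborel I)"
    by (rule meas)
qed

text \<open>Injectivity of \<open>\<gamma>\<close> makes the preimage of \<open>C\<close> in
  \<open>I\<close> countable, hence Lebesgue null, and a density keeps null sets null.\<close>

lemma emeasure_curve_arc_length_countable:
  assumes \<gamma>: "smooth_parametrization \<gamma> I" and C: "countable C"
  shows "emeasure (curve_arc_length \<gamma> I) C = 0"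
proof -
  note m = smooth_parametrization_measurable[OF \<gamma>]
  define M where "M = restrict_space lborel I"
  define f where "f t = ennreal (norm (vector_derivative \<gamma> (at t within I)))" for t
  have f: "f \<in> borel_measurable M" using m(3) unfolding f_def M_def by measurable
  have \<gamma>m: "\<gamma> \<in> measurable (density M f) borel" using m(2) by (simp add: M_def)
  have "inj_on \<gamma> I" using \<gamma> by (simp add: smooth_parametrization_def)
  then have "countable (I \<inter> \<gamma> -` C)" using C by (rule countable_image_inj_Int_vimage)
  then have "I \<inter> \<gamma> -` C \<in> null_sets lborel" by (rule countable_imp_null_set_lborel)
  then have "\<gamma> -` C \<inter> I \<in> null_sets M"
    using m(1) by (simp add: M_def null_sets_restrict_space Int_commute)
  then have "\<gamma> -` C \<inter> I \<in> null_sets (density M f)"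
    using absolutely_continuousI_density[OF f] by (auto simp: absolutely_continuous_def)
  moreover have "curve_arc_length \<gamma> I = distr (density M f) borel \<gamma>"
    by (simp add: curve_arc_length_def M_def f_def[abs_def])
  moreover have "C \<in> sets borel" using C by (rule sets.countable[rotated]) simp
  ultimately show ?thesis
    using \<gamma>m by (simp add: emeasure_distr space_density M_def space_restrict_space Int_commute null_setsD1)
qed

lemma arc_length_measure_countable:
  assumes "arc_length_measure \<Gamma> \<sigma>" and C: "countable C"
  shows "C \<in> null_sets \<sigma>"
proof -
  have "C \<in> sets borel" using C by (rule sets.countable[rotated]) simp
  with assms show ?thesis
    unfolding arc_length_measure_def by (auto simp: null_sets_def emeasure_curve_arc_length_countable)
qed

section \<open>The hyperbola branch as a smooth curve\<close>

lemma smooth_parametrization_hyperbola: "smooth_parametrization (\<lambda>t. (cosh t, sinh t)) UNIV"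
proof -
  \<comment> \<open>Differentiation swaps \<open>cosh\<close> and \<open>sinh\<close>, so the higher
    derivatives have period two.\<close>
  define D :: "nat \<Rightarrow> real \<Rightarrow> real \<times> real"
    where "D k t = (if even k then (cosh t, sinh t) else (sinh t, cosh t))" for k t
  have D: "(D k has_vector_derivative D (Suc k) t) (at t)" for k t
    unfolding D_def
    by (cases "even k")
      (auto intro!: has_vector_derivative_Pair simp: has_real_derivative_iff_has_vector_derivative[symmetric]
        intro!: derivative_eq_intros)
  have D0: "D 0 = (\<lambda>t. (cosh t, sinh t))" by (simp add: D_def fun_eq_iff)
  have "vector_derivative (\<lambda>t. (cosh t, sinh t)) (at t) = D 1 t" for t :: real
    using D[of 0 t] unfolding D0 by (simp add: vector_derivative_at)
  moreover have "D 1 t \<noteq> 0" for t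
    using cosh_real_pos[of t] by (simp add: D_def zero_prod_def)
  moreover have "inj (\<lambda>t::real. (cosh t, sinh t))"
    by (auto intro: injI)
  ultimately show ?thesis
    unfolding smooth_parametrization_def using D D0 by (auto intro!: exI[of _ D])
qed

lemma arc_length_measure_smooth_parametrization:
  assumes "smooth_parametrization \<gamma> I"
  shows "arc_length_measure (\<gamma> ` I) (curve_arc_length \<gamma> I)"
  unfolding arc_length_measure_def
  by (intro exI[of _ "1::nat"] exI[of _ "\<lambda>_. \<gamma>"] exI[of _ "\<lambda>_. I"])
    (use assms in \<open>auto simp: disjoint_family_on_def curve_arc_length_def\<close>)

section \<open>Measures on the hyperbola\<close>

lemma integral_character_mult_eq_0:
  fixes \<mu> :: "(real \<times> real) set \<Rightarrow> complex" and h :: "real \<Rightarrow> complex"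
  assumes \<mu>: "complex_borel_measure \<mu>" and fourier: "\<And>\<xi>. measure_fourier \<mu> (\<xi>, \<eta>) = 0"
    and h: "h \<in> borel_measurable borel" "\<And>x. norm (h x) \<le> K"
  shows "complex_measure_integral \<mu> (\<lambda>z. cis (- (pi * \<eta> * snd z)) * h (fst z)) = 0"
proof -
  define w :: "real \<times> real \<Rightarrow> complex" where "w z = cis (- (pi * \<eta> * snd z))" for z
  have w: "w \<in> borel_measurable borel"
    unfolding w_def by (intro borel_measurable_continuous_onI continuous_intros)
  have p: "fst \<in> borel_measurable (borel :: (real \<times> real) measure)"
    by (intro borel_measurable_continuous_onI continuous_intros)
  have w1: "norm (w z) \<le> 1" for z by (simp add: w_def)
  define \<nu> where "\<nu> = weighted_image \<mu> w fst"
  have \<nu>: "complex_borel_measure \<nu>"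
    unfolding \<nu>_def by (rule complex_borel_measure_weighted_image[OF \<mu> w w1 p])
  have "complex_measure_integral \<nu> (\<lambda>x. iexp (t * x)) = 0" for t
  proof -
    have "complex_measure_integral \<nu> (\<lambda>x. iexp (t * x))
        = complex_measure_integral \<mu> (\<lambda>z. w z * iexp (t * fst z))"
      unfolding \<nu>_def
      by (rule complex_measure_integral_weighted_image[OF \<mu> w w1 p, where K = 1])
        (auto intro!: borel_measurable_continuous_onI continuous_intros)
    \<comment> \<open>The kernel \<open>exp (- \<i> * pi * x * \<xi>)\<close> equals
      \<open>iexp (t * x)\<close> for \<open>\<xi> = - t / pi\<close>, so vanishing for all
      \<open>\<xi>\<close> covers every \<open>t\<close>.\<close>
    also have "(\<lambda>z. w z * iexp (t * fst z))
        = (\<lambda>(x, y). exp (- \<i> * of_real pi * of_real (x * (- t / pi) + y * \<eta>)))"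
      by (auto simp: w_def cis_conv_exp fun_eq_iff algebra_simps simp flip: exp_add)
    also have "complex_measure_integral \<mu> \<dots> = measure_fourier \<mu> (- t / pi, \<eta>)"
      by (simp add: measure_fourier_def)
    finally show ?thesis using fourier by simp
  qed
  then have "\<nu> B = 0" if "B \<in> sets borel" for B
    using complex_measure_eq_0_if_char_eq_0[OF \<nu>] that by blast
  then have "complex_measure_integral \<nu> h = 0"
    using complex_measure_integral_null[OF \<nu>] h(1) by blast
  then show ?thesis
    unfolding \<nu>_def complex_measure_integral_weighted_image[OF \<mu> w w1 p h] by (simp add: w_def)
qed

text \<open>The equation shows that the branch is closed, hence Borel, and that \<open>y\<close>
  determines \<open>x\<close> on it.\<close>

lemma hyperbola_eq: "{(cosh t, sinh t) | t::real. True} = {z. fst z = sqrt (1 + (snd z)\<^sup>2)}"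
proof (intro equalityI subsetI)
  fix z :: "real \<times> real" assume "z \<in> {(cosh t, sinh t) | t::real. True}"
  then obtain t where "z = (cosh t, sinh t)" by blast
  then show "z \<in> {z. fst z = sqrt (1 + (snd z)\<^sup>2)}"
    using cosh_real_nonneg[of t] by (simp add: sinh_square_eq)
next
  fix z :: "real \<times> real" assume "z \<in> {z. fst z = sqrt (1 + (snd z)\<^sup>2)}"
  then have "z = (cosh (arsinh (snd z)), sinh (arsinh (snd z)))"
    by (simp add: prod_eq_iff cosh_arsinh_real add.commute)
  then show "z \<in> {(cosh t, sinh t) | t::real. True}" by blast
qed

text \<open>
  The points \<open>(x, s)\<close> and \<open>(x, -s)\<close> of the hyperbola with \<open>s = sqrt (x\<^sup>2 - 1)\<close> give two linear equations for
  \<open>h\<^sub>1 x\<close> and \<open>h\<^sub>2 x\<close> in \<open>indicator A (x, y) = e\<^sub>1 y * h\<^sub>1 x + e\<^sub>2 y * h\<^sub>2 x\<close>, where \<open>e\<^sub>j y = cis (- pi * \<eta>\<^sub>j * y)\<close>.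
  Their determinant is \<open>2 * \<i> * sin (pi * (\<eta>\<^sub>2 - \<eta>\<^sub>1) * s)\<close>, so the solutions are bounded if the sine is
  bounded away from 0 on \<open>A\<close>.
\<close>
lemma hyperbola_measure_eq_0_if_sine_bounded_below:
  fixes \<mu> :: "(real \<times> real) set \<Rightarrow> complex"
  assumes \<mu>: "complex_borel_measure \<mu>"
    and \<Gamma>: "\<Gamma> = {z. fst z = sqrt (1 + (snd z)\<^sup>2)}"
    and null: "\<And>A. A \<in> sets borel \<Longrightarrow> A \<inter> \<Gamma> = {} \<Longrightarrow> \<mu> A = 0"
    and fourier: "\<And>\<xi>. measure_fourier \<mu> (\<xi>, \<eta>1) = 0" "\<And>\<xi>. measure_fourier \<mu> (\<xi>, \<eta>2) = 0"
    and \<epsilon>: "\<epsilon> > 0"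
    and A: "A \<in> sets borel" "\<And>z. z \<in> A \<Longrightarrow> \<epsilon> \<le> \<bar>sin (pi * (\<eta>2 - \<eta>1) * snd z)\<bar>"
  shows "\<mu> A = 0"
proof -
  \<comment> \<open>For \<open>\<bar>x\<bar> < 1\<close> the root is taken of a negative number; no
    point of the hyperbola lies over such \<open>x\<close>, and the bounds below still hold
    there.\<close>
  define s :: "real \<Rightarrow> real" where "s x = sqrt (x\<^sup>2 - 1)" for x
  define up :: "real \<Rightarrow> complex" where "up x = indicator A (x, s x)" for x
  define lo :: "real \<Rightarrow> complex" where "lo x = indicator A (x, - s x)" for x
  \<comment> \<open>The sign is opposite to that of the characters: the one belonging to
    \<open>\<eta>\<close> is \<open>e \<eta> (- y)\<close>.\<close>
  define e where "e \<eta> y = cis (pi * \<eta> * y)" for \<eta> y :: real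
  \<comment> \<open>Cramer's rule: \<open>d x\<close> is the determinant, and the solution is
    \<open>h\<^sub>1 = H \<eta>2\<close>, \<open>h\<^sub>2 = - H \<eta>1\<close>.\<close>
  define d where "d x = e \<eta>2 (s x) * e \<eta>1 (- s x) - e \<eta>1 (s x) * e \<eta>2 (- s x)" for x
  define H where "H \<eta> x = (up x * e \<eta> (s x) - lo x * e \<eta> (- s x)) / d x" for \<eta> x
  have d: "d x = 2 * \<i> * sin (pi * (\<eta>2 - \<eta>1) * s x)" for x
  proof -
    have "d x = cis (pi * (\<eta>2 - \<eta>1) * s x) - cis (- (pi * (\<eta>2 - \<eta>1) * s x))"
      unfolding d_def e_def cis_mult by (simp add: algebra_simps)
    then show ?thesis by (simp add: complex_eq_iff)
  qed
  have s_cont: "continuous_on UNIV s" unfolding s_def by (intro continuous_intros)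
  have e_cont: "continuous_on UNIV (\<lambda>x. e \<eta> (s x))" "continuous_on UNIV (\<lambda>x. e \<eta> (- s x))" for \<eta>
    unfolding e_def by (intro continuous_intros s_cont)+
  have pair: "(\<lambda>x. (x, s x)) \<in> borel_measurable borel" "(\<lambda>x. (x, - s x)) \<in> borel_measurable borel"
    by (intro borel_measurable_continuous_onI continuous_intros s_cont)+
  have [measurable]: "up \<in> borel_measurable borel" "lo \<in> borel_measurable borel"
    unfolding up_def[abs_def] lo_def[abs_def]
    using A(1) by (auto intro!: measurable_compose[OF pair(1)] measurable_compose[OF pair(2)])
  have [measurable]: "(\<lambda>x. e \<eta> (s x)) \<in> borel_measurable borel" "(\<lambda>x. e \<eta> (- s x)) \<in> borel_measurable borel" for \<eta>
    using e_cont by (auto intro: borel_measurable_continuous_onI)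
  have [measurable]: "d \<in> borel_measurable borel" unfolding d_def[abs_def] by measurable
  have H [measurable]: "H \<eta> \<in> borel_measurable borel" for \<eta>
    unfolding H_def[abs_def] by measurable
  \<comment> \<open>The sine is bounded below on all of \<open>A\<close>, also off the hyperbola,
    and its absolute value is the same at \<open>s x\<close> and \<open>- s x\<close>.\<close>
  have d_bound: "2 * \<epsilon> \<le> norm (d x)" if "up x \<noteq> 0 \<or> lo x \<noteq> 0" for x
    using that A(2)[of "(x, s x)"] A(2)[of "(x, - s x)"]
    by (auto simp: d norm_mult up_def lo_def indicator_def split: if_splits)
  \<comment> \<open>The numerator has norm at most 2. If \<open>up x = lo x = 0\<close>, then
    \<open>H \<eta> x = 0\<close> even where \<open>d x = 0\<close>, as division by 0 yields
    0.\<close>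
  have H_bound: "norm (H \<eta> x) \<le> 2 / (2 * \<epsilon>)" for \<eta> x
  proof (cases "up x = 0 \<and> lo x = 0")
    case False
    have "norm (up x * e \<eta> (s x) - lo x * e \<eta> (- s x)) \<le> norm (up x * e \<eta> (s x)) + norm (lo x * e \<eta> (- s x))"
      by (rule norm_triangle_ineq4)
    also have "\<dots> \<le> 1 + 1"
      by (intro add_mono) (auto simp: norm_mult e_def up_def lo_def indicator_def)
    finally show ?thesis
      unfolding H_def norm_divide using d_bound[of x] False \<epsilon> by (intro frac_le) auto
  qed (use \<epsilon> in \<open>simp add: H_def\<close>)
  have solve: "indicator A z = e \<eta>1 (- snd z) * H \<eta>2 (fst z) + - 1 * (e \<eta>2 (- snd z) * H \<eta>1 (fst z))"
    if z: "z \<in> \<Gamma>" for z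
  proof -
    obtain x y where xy: "z = (x, y)" by (cases z)
    have s: "s x = \<bar>y\<bar>" using z by (simp add: s_def \<Gamma> xy)
    have comb: "e \<eta>1 (- y) * H \<eta>2 x + - 1 * (e \<eta>2 (- y) * H \<eta>1 x)
        = (up x * (e \<eta>2 (s x) * e \<eta>1 (- y) - e \<eta>1 (s x) * e \<eta>2 (- y))
          - lo x * (e \<eta>2 (- s x) * e \<eta>1 (- y) - e \<eta>1 (- s x) * e \<eta>2 (- y))) / d x"
      unfolding H_def by (cases "d x = 0") (simp_all add: field_simps)
    show ?thesis
    proof (cases "y \<ge> 0")
      case True
      then have y: "y = s x" using s by simp
      have "e \<eta>1 (- y) * H \<eta>2 x + - 1 * (e \<eta>2 (- y) * H \<eta>1 x) = up x * d x / d x"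
        unfolding comb unfolding d_def y by (simp add: algebra_simps)
      \<comment> \<open>Either \<open>up x = 0\<close>, or \<open>d x \<noteq> 0\<close> by
        \<open>d_bound\<close>.\<close>
      also have "\<dots> = up x" using d_bound[of x] \<epsilon> by (cases "up x = 0") auto
      finally show ?thesis by (simp add: xy up_def y)
    next
      case False
      then have y: "y = - s x" using s by simp
      have "e \<eta>1 (- y) * H \<eta>2 x + - 1 * (e \<eta>2 (- y) * H \<eta>1 x) = lo x * d x / d x"
        unfolding comb unfolding d_def y by (simp add: algebra_simps)
      also have "\<dots> = lo x" using d_bound[of x] \<epsilon> by (cases "lo x = 0") auto
      finally show ?thesis by (simp add: xy lo_def y)
    qed
  qed
  have fst_m [measurable]: "fst \<in> borel_measurable (borel :: (real \<times> real) measure)"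
    by (intro borel_measurable_continuous_onI continuous_intros)
  have e_m [measurable]: "(\<lambda>z::real \<times> real. e \<eta> (- snd z)) \<in> borel_measurable borel" for \<eta>
    unfolding e_def by (intro borel_measurable_continuous_onI continuous_intros)
  have m: "(\<lambda>z. e \<eta> (- snd z) * H \<eta>' (fst z)) \<in> borel_measurable borel" for \<eta> \<eta>'
    by measurable
  have b: "bounded (range (\<lambda>z. e \<eta> (- snd z) * H \<eta>' (fst z)))" for \<eta> \<eta>'
    by (rule boundedI[of _ "2 / (2 * \<epsilon>)"]) (use H_bound in \<open>auto simp: norm_mult e_def\<close>)
  have m': "(\<lambda>z. - 1 * (e \<eta> (- snd z) * H \<eta>' (fst z))) \<in> borel_measurable borel" for \<eta> \<eta>'
    by measurable
  have b': "bounded (range (\<lambda>z. - 1 * (e \<eta> (- snd z) * H \<eta>' (fst z))))" for \<eta> \<eta>'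
    by (rule boundedI[of _ "2 / (2 * \<epsilon>)"]) (use H_bound in \<open>auto simp: norm_mult e_def\<close>)
  \<comment> \<open>Only the character has to match one of the two lines; \<open>H \<eta>'\<close>
    enters as a bounded Borel function of \<open>x\<close>.\<close>
  have zero: "complex_measure_integral \<mu> (\<lambda>z. e \<eta> (- snd z) * H \<eta>' (fst z)) = 0"
    if "\<eta> = \<eta>1 \<or> \<eta> = \<eta>2" for \<eta> \<eta>'
    using integral_character_mult_eq_0[OF \<mu> _ H H_bound, of \<eta> \<eta>'] fourier that by (auto simp: e_def)
  have "closed \<Gamma>"
    unfolding \<Gamma> by (intro closed_Collect_eq continuous_intros)
  then have "\<Gamma> \<in> sets borel" by (rule borel_closed)
  then have "complex_measure_integral \<mu> (indicator A)
      = complex_measure_integral \<mu> (\<lambda>z. e \<eta>1 (- snd z) * H \<eta>2 (fst z) + - 1 * (e \<eta>2 (- snd z) * H \<eta>1 (fst z)))"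
    by (rule complex_measure_integral_cong_on[OF \<mu>])
      (use null solve A m m' in \<open>auto intro!: borel_measurable_add\<close>)
  also have "\<dots> = complex_measure_integral \<mu> (\<lambda>z. e \<eta>1 (- snd z) * H \<eta>2 (fst z))
      + complex_measure_integral \<mu> (\<lambda>z. - 1 * (e \<eta>2 (- snd z) * H \<eta>1 (fst z)))"
    by (rule complex_measure_integral_add[OF \<mu> m b m' b'])
  also have "\<dots> = 0"
    unfolding complex_measure_integral_mult[OF \<mu>] using zero by simp
  finally show ?thesis by (simp only: complex_measure_integral_indicator[OF \<mu> A(1)])
qed

section \<open>Exhaustion away from the zeros of the sine\<close>

lemma countable_sine_zeros:
  assumes "c \<noteq> 0"
  shows "countable {y::real. sin (c * y) = 0}"
proof (rule countable_subset)
  show "{y. sin (c * y) = 0} \<subseteq> range (\<lambda>i::int. of_int i * pi / c)"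
  proof
    fix y assume "y \<in> {y. sin (c * y) = 0}"
    then obtain i :: int where "c * y = of_int i * pi" unfolding sin_zero_iff_int2 by auto
    then have "y = of_int i * pi / c" using assms by (simp add: field_simps)
    then show "y \<in> range (\<lambda>i::int. of_int i * pi / c)" by blast
  qed
qed simp

text \<open>\<open>A\<close> consists of the increasing sets \<open>B n\<close>, where the sine is
  bounded below, and the zero set \<open>Z\<close>. Each \<open>B n\<close> has measure 0, which
  passes to their union; \<open>Z\<close> meets the hyperbola in a countable, hence null,
  set.\<close>

lemma hyperbola_measure_eq_0:
  fixes \<mu> :: "(real \<times> real) set \<Rightarrow> complex"
  assumes \<mu>: "\<mu> \<in> curve_measures {(cosh t, sinh t) | t. True}" and ne: "\<eta>1 \<noteq> \<eta>2"
    and fourier: "\<And>\<xi>. measure_fourier \<mu> (\<xi>, \<eta>1) = 0" "\<And>\<xi>. measure_fourier \<mu> (\<xi>, \<eta>2) = 0"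
    and A: "A \<in> sets borel"
  shows "\<mu> A = 0"
proof -
  define \<Gamma> :: "(real \<times> real) set" where "\<Gamma> = {z. fst z = sqrt (1 + (snd z)\<^sup>2)}"
  define f :: "real \<times> real \<Rightarrow> real" where "f z = sin (pi * (\<eta>2 - \<eta>1) * snd z)" for z
  obtain \<sigma> where \<sigma>: "arc_length_measure \<Gamma> \<sigma>" and abs: "\<And>A. A \<in> null_sets \<sigma> \<Longrightarrow> \<mu> A = 0"
    and cm: "complex_borel_measure \<mu>" and null: "\<And>A. A \<in> sets borel \<Longrightarrow> A \<inter> \<Gamma> = {} \<Longrightarrow> \<mu> A = 0"
    using \<mu> unfolding curve_measures_def hyperbola_eq \<Gamma>_def by blast
  have add: "borel_countably_additive \<mu>" using cm by (simp add: complex_borel_measure_def)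
  have f: "f \<in> borel_measurable borel"
    unfolding f_def by (intro borel_measurable_continuous_onI continuous_intros)
  have "closed \<Gamma>" unfolding \<Gamma>_def by (intro closed_Collect_eq continuous_intros)
  then have \<Gamma>b: "\<Gamma> \<in> sets borel" by (rule borel_closed)
  \<comment> \<open>\<open>Suc n\<close> avoids the threshold \<open>1 / 0 = 0\<close> at
    \<open>n = 0\<close>, which would admit the zeros of the sine.\<close>
  define B where "B n = A \<inter> {z. 1 / Suc n \<le> \<bar>f z\<bar>}" for n
  define Z where "Z = A \<inter> {z. f z = 0}"
  have B: "B n \<in> sets borel" for n unfolding B_def using A f by measurable
  have Z: "Z \<in> sets borel" unfolding Z_def using A f by measurable
  have UB: "(\<Union>n. B n) = A - Z"
  proof -
    have "\<exists>n. 1 / Suc n \<le> \<bar>f z\<bar>" if "f z \<noteq> 0" for z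
      using nat_approx_posE[of "\<bar>f z\<bar>"] that by (metis less_imp_le zero_less_abs_iff)
    then show ?thesis by (auto simp: B_def Z_def field_simps)
  qed
  have "incseq B"
    unfolding incseq_def B_def by (auto intro: order_trans[rotated] simp: frac_le)
  \<comment> \<open>Continuity from below, by dominated convergence of the indicators.\<close>
  then have "(\<lambda>n. complex_measure_integral \<mu> (indicator (B n))) \<longlonglongrightarrow> complex_measure_integral \<mu> (indicator (\<Union>n. B n))"
    by (intro complex_measure_integral_lim[OF cm, where K = 1] LIMSEQ_indicator_incseq)
      (use B in \<open>auto simp: indicator_def[abs_def]\<close>)
  moreover have "complex_measure_integral \<mu> (indicator (B n)) = 0" for n
    unfolding complex_measure_integral_indicator[OF cm B]
    by (rule hyperbola_measure_eq_0_if_sine_bounded_below[OF cm \<Gamma>_def null fourier, of "1 / Suc n"])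
      (use B in \<open>auto simp: B_def f_def\<close>)
  ultimately have "(\<lambda>n::nat. 0) \<longlonglongrightarrow> complex_measure_integral \<mu> (indicator (A - Z))"
    unfolding UB by simp
  then have "complex_measure_integral \<mu> (indicator (A - Z)) = 0"
    by (simp add: LIMSEQ_const_iff)
  then have 1: "\<mu> (A - Z) = 0"
    using complex_measure_integral_indicator[OF cm, of "A - Z"] A Z by simp
  \<comment> \<open>Each zero \<open>y\<close> of the sine is the height of only one point of the
    hyperbola.\<close>
  have "Z \<inter> \<Gamma> \<subseteq> (\<lambda>y. (sqrt (1 + y\<^sup>2), y)) ` {y. sin (pi * (\<eta>2 - \<eta>1) * y) = 0}"
    by (auto simp: Z_def \<Gamma>_def f_def image_iff)
  moreover have "countable {y. sin (pi * (\<eta>2 - \<eta>1) * y) = 0}"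
    using ne by (intro countable_sine_zeros) simp
  ultimately have "countable (Z \<inter> \<Gamma>)"
    by (rule countable_subset[OF _ countable_image])
  then have 2: "\<mu> (Z \<inter> \<Gamma>) = 0" by (rule abs[OF arc_length_measure_countable[OF \<sigma>]])
  have 3: "\<mu> (Z - \<Gamma>) = 0" by (rule null) (use Z \<Gamma>b in auto)
  have "\<mu> (Z - Z \<inter> \<Gamma>) = \<mu> Z - \<mu> (Z \<inter> \<Gamma>)"
    by (rule borel_countably_additive_Diff[OF add Z]) (use Z \<Gamma>b in auto)
  then have "\<mu> Z = 0" using 2 3 by (simp add: Diff_Int2 Diff_Int)
  moreover have "\<mu> (A - Z) = \<mu> A - \<mu> Z"
    by (rule borel_countably_additive_Diff[OF add A Z]) (simp add: Z_def)
  ultimately show ?thesis using 1 by simp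
qed

theorem theorem2p11:
  fixes L1 L2 :: "(real \<times> real) set"
  assumes "line_parallel_to_X_axis L1" and "line_parallel_to_X_axis L2" and "L1 \<noteq> L2"
  shows "heisenberg_uniqueness_pair {(cosh t, sinh t) | t. True} (L1 \<union> L2)"
proof -
  \<comment> \<open>A horizontal line contains every first coordinate, so it supplies the Fourier
    condition at one height \<open>\<eta>\<close> for all \<open>\<xi>\<close>.\<close>
  have line: "\<exists>\<eta>. L = {z. snd z = \<eta>}" if L: "line_parallel_to_X_axis L" for L
  proof -
    obtain p where p: "L = {p + t *\<^sub>R (1, 0) | t. True}"
      using L unfolding line_parallel_to_X_axis_def by blast
    have "z \<in> L" if "snd z = snd p" for z
      unfolding p using that by (auto intro!: exI[of _ "fst z - fst p"] simp: prod_eq_iff)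
    then have "L = {z. snd z = snd p}" by (auto simp: p)
    then show ?thesis by blast
  qed
  obtain \<eta>1 \<eta>2 where \<eta>: "L1 = {z. snd z = \<eta>1}" "L2 = {z. snd z = \<eta>2}"
    using line assms(1,2) by blast
  then have "\<eta>1 \<noteq> \<eta>2" using assms(3) by auto
  have "\<exists>\<sigma>. arc_length_measure {(cosh t, sinh t) | t::real. True} \<sigma>"
    using arc_length_measure_smooth_parametrization[OF smooth_parametrization_hyperbola]
    by (auto simp: full_SetCompr_eq)
  then show ?thesis
    unfolding heisenberg_uniqueness_pair_def
    using hyperbola_measure_eq_0[OF _ \<open>\<eta>1 \<noteq> \<eta>2\<close>] by (simp add: \<eta>)
qed

end
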